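(* Let $\lambda$ be a nonzero real number. For integers $n,r\ge0$ define $T_n(x,r\mid\lambda)=\sum_{k=0}^{n}\binom{n}{k}x^k(k)_{r,\lambda}$. Then for all integers $n,r\ge0$ and every $x\neq-1$, $$ T_{n}(x,r\mid\lambda)=(1+x)^{n}\sum_{j=0}^{r}(-1)^{j}\binom{n}{j}\Big(\frac{x}{1+x}\Big)^{j}\sum_{k=0}^{j}(-1)^{k}\binom{j}{k}(k)_{r,\lambda}. $$ In particular, $$ T_{n}(1,r\mid\lambda)=2^{n}\sum_{j=0}^{r}(-1)^{j}\frac{\binom{n}{j}}{2^{j}}\sum_{k=0}^{j}(-1)^{k}\binom{j}{k}(k)_{r,\lambda}. $$
   Context: For a real parameter $\mu$ the degenerate falling factorials are $(x)_{0,\mu}=1$ and $(x)_{n,\mu}=x(x-\mu)\cdots(x-(n-1)\mu)$ for $n\ge1$. Binomial coefficients $\binom{n}{j}$ for integers $0\le n<j$ are $0$. *)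

theory Defs
  imports Complex_Main
begin

definition deg_ffact :: "real \<Rightarrow> real \<Rightarrow> nat \<Rightarrow> real" where
  "deg_ffact \<mu> x n = (\<Prod>i<n. x - real i * \<mu>)"

definition T :: "real \<Rightarrow> nat \<Rightarrow> real \<Rightarrow> nat \<Rightarrow> real" where
  "T lam n x r = (\<Sum>k=0..n. real (n choose k) * x ^ k * deg_ffact lam (real k) r)"

end

theory Submission
  imports Defs
begin

text \<open>
  Both sides are linear in the sequence \<open>k \<mapsto> (k)\<^sub>r\<^sub>,\<^sub>\<lambda>\<close>, which is a linear combination of the
  sequences \<open>k \<mapsto> k choose m\<close> with \<open>m \<le> r\<close>. For such a basis sequence the left-hand side is
  \<open>(n choose m) x\<^sup>m (1 + x)\<^sup>n\<^sup>-\<^sup>m\<close>, and the same identity at \<open>x = -1\<close> shows that the inner alternating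
  sum on the right vanishes except at \<open>j = m\<close>.
\<close>

text \<open>Choosing a \<open>k\<close>-set and then an \<open>m\<close>-subset of it amounts to
  choosing the \<open>m\<close>-set first and extending it. This pulls \<open>n choose m\<close> out
  of the sum, and the binomial theorem for exponent \<open>n - m\<close> remains.\<close>

lemma sum_choose_mult_power:
  fixes x :: "'a::comm_semiring_1"
  assumes "m \<le> n"
  shows "(\<Sum>k=0..n. of_nat (n choose k) * x ^ k * of_nat (k choose m))
    = of_nat (n choose m) * x ^ m * (1 + x) ^ (n - m)"
proof -
  have "(\<Sum>k=0..n. of_nat (n choose k) * x ^ k * of_nat (k choose m))
      = (\<Sum>k=m..n. of_nat (n choose k) * x ^ k * of_nat (k choose m))"
    by (rule sum.mono_neutral_right) (auto simp: not_le binomial_eq_0)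
  also have "\<dots> = (\<Sum>k=m..n. of_nat (n choose m) * x ^ m * (of_nat ((n - m) choose (k - m)) * x ^ (k - m)))"
  proof (rule sum.cong)
    fix k assume k: "k \<in> {m..n}"
    then have "(n choose k) * (k choose m) = (n choose m) * ((n - m) choose (k - m))"
      by (intro choose_mult) auto
    then have "of_nat (n choose k) * of_nat (k choose m)
        = (of_nat (n choose m) * of_nat ((n - m) choose (k - m)) :: 'a)"
      by (metis of_nat_mult)
    moreover have "x ^ k = x ^ m * x ^ (k - m)"
      using k by (simp flip: power_add)
    ultimately show "of_nat (n choose k) * x ^ k * of_nat (k choose m)
        = of_nat (n choose m) * x ^ m * (of_nat ((n - m) choose (k - m)) * x ^ (k - m))"
      by (metis (no_types, lifting) mult.assoc mult.commute)
  qed simp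
  also have "\<dots> = of_nat (n choose m) * x ^ m * (\<Sum>k=m..n. of_nat ((n - m) choose (k - m)) * x ^ (k - m))"
    by (simp add: sum_distrib_left)
  also have "(\<Sum>k=m..n. of_nat ((n - m) choose (k - m)) * x ^ (k - m))
      = (\<Sum>i\<le>n - m. of_nat ((n - m) choose i) * x ^ i)"
    by (rule sum.reindex_bij_witness[of _ "\<lambda>i. i + m" "\<lambda>k. k - m"]) (use assms in auto)
  also have "\<dots> = (1 + x) ^ (n - m)"
    using binomial_ring[of x 1 "n - m"] by (simp add: add.commute)
  finally show ?thesis .
qed

text \<open>At \<open>x = -1\<close> the closed form of \<open>sum_choose_mult_power\<close> has the
  factor \<open>0 ^ (j - m)\<close>, which is 1 only for \<open>j = m\<close>. For
  \<open>m > j\<close> every \<open>k choose m\<close> in the sum is 0.\<close>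

lemma alternating_sum_choose_mult:
  "(\<Sum>k=0..j. (-1) ^ k * real (j choose k) * real (k choose m)) = (if j = m then (-1) ^ m else 0)"
proof (cases "m \<le> j")
  case True
  then show ?thesis
    using sum_choose_mult_power[of m j "-1 :: real"] by (simp add: mult.commute power_0_left)
next
  case False
  then have "(\<Sum>k=0..j. (-1) ^ k * real (j choose k) * real (k choose m)) = 0"
    by (intro sum.neutral) auto
  with False show ?thesis by auto
qed

lemma deg_ffact_newton_expansion:
  "\<exists>c. \<forall>k::nat. deg_ffact \<mu> (real k) r = (\<Sum>m=0..r. c m * real (k choose m))"
proof (induction r)
  case 0
  show ?case by (rule exI[of _ "\<lambda>_. 1"]) (simp add: deg_ffact_def)
next
  case (Suc r)
  then obtain c where c: "\<And>k. deg_ffact \<mu> (real k) r = (\<Sum>m=0..r. c m * real (k choose m))"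
    by blast
  \<comment> \<open>Multiplying by \<open>real k - real r * \<mu>\<close> sends \<open>c m\<close>
    to index \<open>m + 1\<close> with weight \<open>m + 1\<close> and back to index
    \<open>m\<close> with weight \<open>m - r * \<mu>\<close>. The conditionals cover the ends:
    index 0 receives nothing from below, and index \<open>Suc r\<close> has no old
    coefficient.\<close>
  define d where "d m = (if m = 0 then 0 else real m * c (m - 1))
    + (if m \<le> r then (real m - real r * \<mu>) * c m else 0)" for m
  have "deg_ffact \<mu> (real k) (Suc r) = (\<Sum>m=0..Suc r. d m * real (k choose m))" for k
  proof -
    \<comment> \<open>Split \<open>k\<close> as \<open>(k - m) + m\<close> and absorb
      \<open>k - m\<close> into the binomial coefficient.\<close>
    have absorb: "real k * real (k choose m) = real (Suc m) * real (k choose Suc m) + real m * real (k choose m)" for m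
    proof (cases "m \<le> k")
      case True
      have "Suc m * (k choose Suc m) = (k - m) * (k choose m)"
        by (metis binomial_absorb_comp binomial_absorption)
      then have "real (Suc m) * real (k choose Suc m) = (real k - real m) * real (k choose m)"
        using True by (metis of_nat_diff of_nat_mult)
      then show ?thesis by (simp add: algebra_simps)
    qed (simp add: binomial_eq_0)
    have "deg_ffact \<mu> (real k) (Suc r) = (\<Sum>m=0..r. c m * real (k choose m)) * (real k - real r * \<mu>)"
      using c[of k] by (simp add: deg_ffact_def)
    also have "\<dots> = (\<Sum>m=0..r. c m * (real k * real (k choose m)) - c m * (real r * \<mu>) * real (k choose m))"
      unfolding sum_distrib_right by (simp add: algebra_simps)
    also have "\<dots> = (\<Sum>m=0..r. real (Suc m) * c m * real (k choose Suc m))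
        + (\<Sum>m=0..r. (real m - real r * \<mu>) * c m * real (k choose m))"
      unfolding absorb by (simp add: algebra_simps flip: sum.distrib)
    also have "(\<Sum>m=0..r. real (Suc m) * c m * real (k choose Suc m))
        = (\<Sum>m=0..Suc r. (if m = 0 then 0 else real m * c (m - 1)) * real (k choose m))"
      by (subst sum.atLeast0_atMost_Suc_shift) simp
    also have "(\<Sum>m=0..r. (real m - real r * \<mu>) * c m * real (k choose m))
        = (\<Sum>m=0..Suc r. (if m \<le> r then (real m - real r * \<mu>) * c m else 0) * real (k choose m))"
      by simp
    finally show ?thesis
      unfolding d_def by (simp only: distrib_right sum.distrib)
  qed
  then show ?case by blast
qed

text \<open>The alternating sums recover the Newton coefficients \<open>c j\<close> up to sign, so
  the right-hand side is the left-hand side expanded in the basis \<open>k choose m\<close>. Since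
  \<open>c\<close> stops at \<open>r\<close>, so does the outer sum.\<close>

lemma sum_choose_power_newton:
  fixes x :: real
  assumes x: "x \<noteq> -1" and f: "\<And>k. f k = (\<Sum>m=0..r. c m * real (k choose m))"
  shows "(\<Sum>k=0..n. real (n choose k) * x ^ k * f k)
    = (1 + x) ^ n * (\<Sum>j=0..r. (-1) ^ j * real (n choose j) * (x / (1 + x)) ^ j *
        (\<Sum>k=0..j. (-1) ^ k * real (j choose k) * f k))"
proof -
  have inner: "(\<Sum>k=0..j. (-1) ^ k * real (j choose k) * f k) = (-1) ^ j * c j" if "j \<le> r" for j
  proof -
    have "(\<Sum>k=0..j. (-1) ^ k * real (j choose k) * f k)
        = (\<Sum>m=0..r. c m * (\<Sum>k=0..j. (-1) ^ k * real (j choose k) * real (k choose m)))"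
      unfolding f sum_distrib_left by (subst sum.swap) (simp add: mult_ac)
    also have "\<dots> = (\<Sum>m=0..r. if j = m then c m * (-1) ^ m else 0)"
      unfolding alternating_sum_choose_mult by (intro sum.cong) auto
    finally show ?thesis using that by simp
  qed
  \<comment> \<open>As \<open>1 + x\<close> is nonzero, \<open>(1 + x) ^ (n - m)\<close> can be
    written as a quotient, which frees the factor \<open>(1 + x) ^ n\<close> from \<open>m\<close>.
    For \<open>m > n\<close>, possible when \<open>r > n\<close>, both sides are 0.\<close>
  have outer: "(\<Sum>k=0..n. real (n choose k) * x ^ k * real (k choose m))
      = (1 + x) ^ n * (real (n choose m) * (x / (1 + x)) ^ m)" for m
  proof (cases "m \<le> n")
    case True
    then have "(1 + x) ^ n = (1 + x) ^ m * (1 + x) ^ (n - m)"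
      by (simp flip: power_add)
    moreover have "1 + x \<noteq> 0" using x by linarith
    ultimately show ?thesis
      using sum_choose_mult_power[OF True, of x] by (simp add: power_divide)
  next
    case False
    then have "(\<Sum>k=0..n. real (n choose k) * x ^ k * real (k choose m)) = 0"
      by (intro sum.neutral) auto
    with False show ?thesis by simp
  qed
  have "(\<Sum>k=0..n. real (n choose k) * x ^ k * f k)
      = (\<Sum>m=0..r. c m * (\<Sum>k=0..n. real (n choose k) * x ^ k * real (k choose m)))"
    unfolding f sum_distrib_left by (subst sum.swap) (simp add: mult_ac)
  \<comment> \<open>The sign is inserted twice, as \<open>(-1) ^ j * (-1) ^ j = 1\<close>, so that
    \<open>inner\<close> can replace \<open>(-1) ^ j * c j\<close>.\<close>
  also have "\<dots> = (1 + x) ^ n * (\<Sum>j=0..r. (-1) ^ j * real (n choose j) * (x / (1 + x)) ^ j * ((-1) ^ j * c j))"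
    unfolding outer sum_distrib_left
    by (intro sum.cong refl) (simp add: mult_ac flip: power_mult_distrib)
  also have "\<dots> = (1 + x) ^ n * (\<Sum>j=0..r. (-1) ^ j * real (n choose j) * (x / (1 + x)) ^ j *
      (\<Sum>k=0..j. (-1) ^ k * real (j choose k) * f k))"
    using inner by simp
  finally show ?thesis .
qed

theorem theorem2p18:
  fixes lam :: real
  assumes "lam \<noteq> 0"
  shows "(\<forall>(n::nat) (r::nat) (x::real). x \<noteq> -1 \<longrightarrow>
            T lam n x r =
              (1 + x) ^ n * (\<Sum>j=0..r. (-1) ^ j * real (n choose j) * (x / (1 + x)) ^ j *
                (\<Sum>k=0..j. (-1) ^ k * real (j choose k) * deg_ffact lam (real k) r)))
       \<and> (\<forall>(n::nat) (r::nat).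
            T lam n 1 r =
              2 ^ n * (\<Sum>j=0..r. (-1) ^ j * (real (n choose j) / 2 ^ j) *
                (\<Sum>k=0..j. (-1) ^ k * real (j choose k) * deg_ffact lam (real k) r)))"
proof -
  have main: "T lam n x r = (1 + x) ^ n * (\<Sum>j=0..r. (-1) ^ j * real (n choose j) * (x / (1 + x)) ^ j *
      (\<Sum>k=0..j. (-1) ^ k * real (j choose k) * deg_ffact lam (real k) r))"
    if "x \<noteq> -1" for n r and x :: real
  proof -
    obtain c where "\<And>k::nat. deg_ffact lam (real k) r = (\<Sum>m=0..r. c m * real (k choose m))"
      using deg_ffact_newton_expansion by blast
    from sum_choose_power_newton[OF that this] show ?thesis
      unfolding T_def .
  qed
  moreover have "T lam n 1 r = 2 ^ n * (\<Sum>j=0..r. (-1) ^ j * (real (n choose j) / 2 ^ j) *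
      (\<Sum>k=0..j. (-1) ^ k * real (j choose k) * deg_ffact lam (real k) r))" for n r
    using main[of 1 n r] by (simp add: power_divide)
  ultimately show ?thesis by blast
qed

end
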